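(* Let $X=\Gamma\backslash\mathbb{H}^2$ be a compact hyperbolic orbisurface and let $\{\rho_N\}_{N\ge1}$ be a sequence of finite-dimensional complex representations $\rho_N:\pi_1(X_1)\to\mathrm{GL}(V_{\rho_N})$ with $\rho_N(u)=e^{-i\pi m_N}\mathrm{Id}$, $m_N\in(-1,1]$, such that $\mathrm{Tr}(\rho_N(\gamma_j))$ is uniformly bounded by some constant $C(X)$ which is independent of $j$ and $N$. Assume also that $\lim_{N\to\infty}\dim(V_{\rho_N})=\infty$. Let $\widetilde C=\widetilde C(\rho_N)$ denote the torsion factor of $\rho_N$, where for $\rho$ with $\rho(u)=e^{-i\pi m}\mathrm{Id}$, $$\widetilde C(\rho)=-\dim(V_\rho)\chi(X)\big(2\zeta'(-1)-\log\sqrt{2\pi}\big)+\sum_{j=1}^r\frac{\log\nu_j}{2\nu_j}\sum_{k=1}^{\nu_j-1}\frac{\mathrm{Tr}(\rho(\gamma_j)^k)e^{i\pi km/\nu_j}}{\sin^2(\pi k/\nu_j)}.$$ Then $$\lim_{N\to\infty}\frac{\widetilde C(\rho_N)}{\dim(V_{\rho_N})}=-\chi(X)\big(2\zeta'(-1)-\log\sqrt{2\pi}\big).$$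
   Context: $\Gamma\subset\mathrm{PSL}(2,\mathbb{R})$ is a cocompact Fuchsian group, $X=\Gamma\backslash\mathbb{H}^2$, $X_1=\Gamma\backslash\mathrm{PSL}(2,\mathbb{R})$ its unit tangent bundle; $\pi_1(X_1)$ is identified with the preimage $\widetilde\Gamma$ of $\Gamma$ in the universal cover $\widetilde G$ of $\mathrm{PSL}(2,\mathbb{R})$. With $\widetilde k_\theta$ the lift to $\widetilde G$ of the one-parameter group $k_\theta=\begin{pmatrix}\cos\theta&\sin\theta\\-\sin\theta&\cos\theta\end{pmatrix}$, $u=\widetilde k_\pi$ is the generator of the center of $\widetilde G$. $X$ has genus $g$ and $r\ge0$ elliptic points of orders $\nu_1,\dots,\nu_r\geq 2$; $\gamma_j\in\widetilde\Gamma$ maps to a generator of the stabilizer in $\Gamma$ of (a lift of) the $j$-th elliptic point and is conjugate in $\widetilde G$ to $\widetilde k_{\pi/\nu_j}$, so $\gamma_j^{\nu_j}=u$. $\chi(X)=2-2g+\sum_{j=1}^r(\frac1{\nu_j}-1)$, and $\zeta$ is the Riemann zeta function.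
   Formalization: The uniform bound is assumed for the traces of all powers ρ_N(γ_j)^k with 1 ≤ k ≤ ν_j−1, not only for Tr(ρ_N(γ_j)); with the bound for k=1 alone the claim fails, e.g. for orders (4,4) in genus 1. *)

theory Defs
  imports
    "HOL-Complex_Analysis.Complex_Analysis"
    "HOL-Homology.Homology"
    "HOL-Algebra.Free_Abelian_Groups"
    "Jordan_Normal_Form.Matrix"
begin

(* Both HOL-Analysis and Jordan_Normal_Form declare these; from here on they refer to
   matrices over finite index types, except that the type "complex mat" is the dynamic one. *)
hide_const (open) Matrix.mat Matrix.vec
no_notation Matrix.vec_index (infixl "$" 100)


section \<open>Topological preliminaries\<close>

definition quotient_topology :: "'a topology \<Rightarrow> ('a \<Rightarrow> 'b) \<Rightarrow> 'b topology" where
  "quotient_topology X f =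
     topology (\<lambda>U. U \<subseteq> f ` topspace X \<and> openin X {x \<in> topspace X. f x \<in> U})"

lemma openin_quotient_topology:
  "openin (quotient_topology X f) U \<longleftrightarrow>
     U \<subseteq> f ` topspace X \<and> openin X {x \<in> topspace X. f x \<in> U}"
proof -
  have "istopology (\<lambda>U. U \<subseteq> f ` topspace X \<and> openin X {x \<in> topspace X. f x \<in> U})"
    unfolding istopology_def
  proof (intro conjI allI impI)
    fix S T
    assume S: "S \<subseteq> f ` topspace X \<and> openin X {x \<in> topspace X. f x \<in> S}"
       and T: "T \<subseteq> f ` topspace X \<and> openin X {x \<in> topspace X. f x \<in> T}"
    show "S \<inter> T \<subseteq> f ` topspace X" using S by blast
    have "{x \<in> topspace X. f x \<in> S \<inter> T} =
          {x \<in> topspace X. f x \<in> S} \<inter> {x \<in> topspace X. f x \<in> T}" by blast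
    then show "openin X {x \<in> topspace X. f x \<in> S \<inter> T}" using S T by auto
  next
    fix K
    assume K: "\<forall>k\<in>K. k \<subseteq> f ` topspace X \<and> openin X {x \<in> topspace X. f x \<in> k}"
    show "\<Union>K \<subseteq> f ` topspace X" using K by blast
    have "{x \<in> topspace X. f x \<in> \<Union>K} = \<Union>((\<lambda>k. {x \<in> topspace X. f x \<in> k}) ` K)" by blast
    then show "openin X {x \<in> topspace X. f x \<in> \<Union>K}" using K by auto
  qed
  then show ?thesis by (simp add: quotient_topology_def topology_inverse')
qed

lemma quotient_map_quotient_topology: "quotient_map X (quotient_topology X f) f"
proof -
  have "topspace (quotient_topology X f) = f ` topspace X" (is "?L = ?R")
  proof
    show "?L \<subseteq> ?R" by (metis openin_quotient_topology openin_topspace)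
    have "{x \<in> topspace X. f x \<in> f ` topspace X} = topspace X" by auto
    then show "?R \<subseteq> ?L" by (intro openin_subset) (simp add: openin_quotient_topology)
  qed
  then show ?thesis by (auto simp: quotient_map_def openin_quotient_topology)
qed


section \<open>The universal covering group\<close>

(* A path enters only through its restriction to the unit interval. *)
definition based_paths :: "('a, 'b) monoid_scheme \<Rightarrow> 'a topology \<Rightarrow> (real \<Rightarrow> 'a) set" where
  "based_paths G T = {p. pathin T p \<and> p 0 = \<one>\<^bsub>G\<^esub>}"

definition path_class :: "'a topology \<Rightarrow> (real \<Rightarrow> 'a) \<Rightarrow> (real \<Rightarrow> 'a) set" where
  "path_class T p =
     {q. homotopic_with (\<lambda>h. h 0 = p 0 \<and> h 1 = p 1) (top_of_set {0..1}) T p q}"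

(* The universal cover of a path-connected (and locally nice) topological group, as the set of
   homotopy classes rel endpoints of paths starting at the identity, under pointwise
   multiplication of paths.  The union in the product is over representatives, all of which
   give the same class. *)
definition universal_cover :: "('a, 'b) monoid_scheme \<Rightarrow> 'a topology \<Rightarrow> (real \<Rightarrow> 'a) set monoid" where
  "universal_cover G T =
     \<lparr>carrier = path_class T ` based_paths G T,
      mult = (\<lambda>a b. \<Union>p\<in>a. \<Union>q\<in>b. path_class T (\<lambda>t. p t \<otimes>\<^bsub>G\<^esub> q t)),
      one = path_class T (\<lambda>t. \<one>\<^bsub>G\<^esub>)\<rparr>"

(* The covering projection: the common endpoint of the paths in a class. *)
definition cover_proj :: "(real \<Rightarrow> 'a) set \<Rightarrow> 'a" where
  "cover_proj a = the_elem ((\<lambda>p. p 1) ` a)"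


section \<open>PSL(2,R), its universal cover, and the hyperbolic plane\<close>

definition SL2R :: "(real^2^2) monoid" where
  "SL2R = \<lparr>carrier = {A. Determinants.det A = 1}, mult = (**), one = mat 1\<rparr>"

definition PSL2R :: "(real^2^2) set monoid" where
  "PSL2R = SL2R Mod {mat 1, - mat 1}"

definition to_PSL :: "real^2^2 \<Rightarrow> (real^2^2) set" where
  "to_PSL A = {mat 1, - mat 1} #>\<^bsub>SL2R\<^esub> A"

definition PSL2R_top :: "(real^2^2) set topology" where
  "PSL2R_top = quotient_topology (top_of_set (carrier SL2R)) to_PSL"

definition cover_PSL2R :: "(real \<Rightarrow> (real^2^2) set) set monoid" where
  "cover_PSL2R = universal_cover PSL2R PSL2R_top"

definition rot :: "real \<Rightarrow> real^2^2" where
  "rot \<theta> = vector [vector [cos \<theta>, sin \<theta>], vector [- sin \<theta>, cos \<theta>]]"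

(* The lift to the universal cover of the one-parameter group of rotations: its value at \<theta>
   is represented by the path running from rot 0 to rot \<theta>. *)
definition rot_lift :: "real \<Rightarrow> (real \<Rightarrow> (real^2^2) set) set" where
  "rot_lift \<theta> = path_class PSL2R_top (\<lambda>t. to_PSL (rot (t * \<theta>)))"

definition central_u :: "(real \<Rightarrow> (real^2^2) set) set" where
  "central_u = rot_lift pi"

definition upper_half_plane :: "complex set" where
  "upper_half_plane = {z. Im z > 0}"

definition act :: "real^2^2 \<Rightarrow> complex \<Rightarrow> complex" where
  "act A z = moebius (complex_of_real (A $ 1 $ 1)) (complex_of_real (A $ 1 $ 2))
                     (complex_of_real (A $ 2 $ 1)) (complex_of_real (A $ 2 $ 2)) z"

(* Elements of PSL(2,R) are cosets {A, -A}, whose two members act in the same way. *)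
definition orbit_of :: "(real^2^2) set set \<Rightarrow> complex \<Rightarrow> complex set" where
  "orbit_of \<Gamma> z = {act A z | A. \<exists>p\<in>\<Gamma>. A \<in> p}"

definition stabilizer_of :: "(real^2^2) set set \<Rightarrow> complex \<Rightarrow> (real^2^2) set set" where
  "stabilizer_of \<Gamma> z = {p \<in> \<Gamma>. \<forall>A\<in>p. act A z = z}"


section \<open>Compact hyperbolic orbisurfaces\<close>

definition orbit_space :: "(real^2^2) set set \<Rightarrow> complex set topology" where
  "orbit_space \<Gamma> = quotient_topology (top_of_set upper_half_plane) (orbit_of \<Gamma>)"

definition cocompact_fuchsian :: "(real^2^2) set set \<Rightarrow> bool" where
  "cocompact_fuchsian \<Gamma> \<longleftrightarrow>
     subgroup \<Gamma> PSL2R \<and>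
     subtopology PSL2R_top \<Gamma> = discrete_topology \<Gamma> \<and>
     compact_space (orbit_space \<Gamma>)"

(* The space underlying an orbisurface is a closed oriented surface; its genus is half the rank
   of its first integral homology. *)
definition has_genus :: "'a topology \<Rightarrow> nat \<Rightarrow> bool" where
  "has_genus X g \<longleftrightarrow> homology_group 1 X \<cong> free_Abelian_group {..<2 * g}"

definition elliptic_points :: "(real^2^2) set set \<Rightarrow> complex set set" where
  "elliptic_points \<Gamma> =
     {orbit_of \<Gamma> w | w. w \<in> upper_half_plane \<and> stabilizer_of \<Gamma> w \<noteq> {\<one>\<^bsub>PSL2R\<^esub>}}"

(* The fundamental group of the unit tangent bundle of the orbisurface, identified with the
   preimage of \<Gamma> in the universal cover of PSL(2,R). *)
definition pi1_unit_tangent :: "(real^2^2) set set \<Rightarrow> (real \<Rightarrow> (real^2^2) set) set monoid" where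
  "pi1_unit_tangent \<Gamma> =
     cover_PSL2R\<lparr>carrier := {a \<in> carrier cover_PSL2R. cover_proj a \<in> \<Gamma>}\<rparr>"

(* \<gamma> maps to a generator of the stabilizer of z, of order \<nu>, and is conjugate in the
   universal cover to the lifted rotation at pi / \<nu>. *)
definition elliptic_generator ::
  "(real^2^2) set set \<Rightarrow> complex \<Rightarrow> nat \<Rightarrow> (real \<Rightarrow> (real^2^2) set) set \<Rightarrow> bool" where
  "elliptic_generator \<Gamma> z \<nu> \<gamma> \<longleftrightarrow>
     \<gamma> \<in> carrier (pi1_unit_tangent \<Gamma>) \<and>
     generate PSL2R {cover_proj \<gamma>} = stabilizer_of \<Gamma> z \<and>
     (\<exists>h\<in>carrier cover_PSL2R.
        \<gamma> = h \<otimes>\<^bsub>cover_PSL2R\<^esub> rot_lift (pi / real \<nu>) \<otimes>\<^bsub>cover_PSL2R\<^esub> inv\<^bsub>cover_PSL2R\<^esub> h)"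

definition orbifold_euler_char :: "nat \<Rightarrow> nat \<Rightarrow> (nat \<Rightarrow> nat) \<Rightarrow> real" where
  "orbifold_euler_char g r \<nu> = 2 - 2 * real g + (\<Sum>j=1..r. 1 / real (\<nu> j) - 1)"


section \<open>Representations and the torsion factor\<close>

definition GL :: "nat \<Rightarrow> complex mat monoid" where
  "GL n = units_of (ring_mat TYPE(complex) n ())"

definition mat_trace :: "complex mat \<Rightarrow> complex" where
  "mat_trace A = (\<Sum>i<dim_row A. A $$ (i, i))"

(* The analytic continuation of the Dirichlet series to the plane without 1; it is unique by the
   identity theorem except for the irrelevant value at 1. *)
definition riemann_zeta :: "complex \<Rightarrow> complex" where
  "riemann_zeta = (SOME f. f holomorphic_on (- {1}) \<and>
     (\<forall>s. Re s > 1 \<longrightarrow> (\<lambda>n. 1 / of_nat (Suc n) powr s) sums f s))"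

(* For a representation \<rho> on C^n with \<rho>(u) = exp(- i pi m) Id.  The traces of all powers
   \<rho>(\<gamma> j)^k with 0 < k < \<nu> j enter; for \<nu> j > 2 a bound on the trace of
   \<rho>(\<gamma> j) alone does not bound them (diag(1, -1) has trace 0, its square has trace 2). *)
definition torsion_factor ::
  "nat \<Rightarrow> nat \<Rightarrow> (nat \<Rightarrow> nat) \<Rightarrow> (nat \<Rightarrow> 'a) \<Rightarrow> nat \<Rightarrow> real \<Rightarrow> ('a \<Rightarrow> complex mat) \<Rightarrow> complex" where
  "torsion_factor g r \<nu> \<gamma> n m \<rho> =
     - of_nat n * complex_of_real (orbifold_euler_char g r \<nu>) *
         (2 * deriv riemann_zeta (-1) - complex_of_real (ln (sqrt (2 * pi))))
     + (\<Sum>j=1..r. complex_of_real (ln (real (\<nu> j)) / (2 * real (\<nu> j))) *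
         (\<Sum>k=1..\<nu> j - 1.
            mat_trace (\<rho> (\<gamma> j) ^\<^sub>m k)
              * exp (\<i> * complex_of_real (pi * real k * m / real (\<nu> j)))
              / complex_of_real ((sin (pi * real k / real (\<nu> j)))\<^sup>2)))"

end

theory Submission
  imports Defs
begin

text \<open>
  The torsion factor is a multiple of the dimension plus a finite sum over the elliptic points,
  and the multiple divided by the dimension is the asserted limit exactly.  The elliptic sum
  depends on the representation only through the traces, which are bounded by \<open>C\<close>, and through
  the phases \<open>exp (\<i> pi k m / \<nu>)\<close>, which have modulus one because \<open>m\<close> is real;
  the weights \<open>ln \<nu> / (2 \<nu>)\<close> and \<open>1 / sin\<^sup>2\<close> and the number of terms belong to the orbisurface.
  So the elliptic sum is bounded uniformly in \<open>N\<close> (\<open>norm_elliptic_contribution_le\<close>),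
  and it disappears after division by a dimension tending to infinity.
\<close>

definition elliptic_contribution ::
  "nat \<Rightarrow> (nat \<Rightarrow> nat) \<Rightarrow> (nat \<Rightarrow> 'a) \<Rightarrow> real \<Rightarrow> ('a \<Rightarrow> complex mat) \<Rightarrow> complex" where
  "elliptic_contribution r \<nu> \<gamma> m \<rho> =
     (\<Sum>j=1..r. complex_of_real (ln (real (\<nu> j)) / (2 * real (\<nu> j))) *
         (\<Sum>k=1..\<nu> j - 1.
            mat_trace (\<rho> (\<gamma> j) ^\<^sub>m k)
              * exp (\<i> * complex_of_real (pi * real k * m / real (\<nu> j)))
              / complex_of_real ((sin (pi * real k / real (\<nu> j)))\<^sup>2)))"

lemma torsion_factor_div_dim:
  assumes "n > 0"
  shows "torsion_factor g r \<nu> \<gamma> n m \<rho> / of_nat n =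
           - complex_of_real (orbifold_euler_char g r \<nu>) *
             (2 * deriv riemann_zeta (-1) - complex_of_real (ln (sqrt (2 * pi))))
           + elliptic_contribution r \<nu> \<gamma> m \<rho> / of_nat n"
  using assms unfolding torsion_factor_def elliptic_contribution_def[symmetric]
  by (simp add: field_simps)

text \<open>
  Bounding every trace by \<open>C\<close> and every phase by its modulus, which is one, leaves an expression
  free of \<open>m\<close> and \<open>\<rho>\<close>; that is what makes the estimate uniform along a sequence of
  representations.
\<close>
lemma norm_elliptic_contribution_le:
  assumes trace: "\<And>j k. j \<in> {1..r} \<Longrightarrow> k \<in> {1..\<nu> j - 1} \<Longrightarrow>
                    cmod (mat_trace (\<rho> (\<gamma> j) ^\<^sub>m k)) \<le> C"
  shows "cmod (elliptic_contribution r \<nu> \<gamma> m \<rho>) \<le>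
           (\<Sum>j=1..r. \<bar>ln (real (\<nu> j)) / (2 * real (\<nu> j))\<bar> *
             (\<Sum>k=1..\<nu> j - 1. C / (sin (pi * real k / real (\<nu> j)))\<^sup>2))"
  unfolding elliptic_contribution_def
proof (rule sum_norm_le)
  fix j assume j: "j \<in> {1..r}"
  have "cmod (mat_trace (\<rho> (\<gamma> j) ^\<^sub>m k)
              * exp (\<i> * complex_of_real (pi * real k * m / real (\<nu> j)))
              / complex_of_real ((sin (pi * real k / real (\<nu> j)))\<^sup>2))
          \<le> C / (sin (pi * real k / real (\<nu> j)))\<^sup>2" if "k \<in> {1..\<nu> j - 1}" for k
  proof -
    have "cmod (exp (\<i> * complex_of_real (pi * real k * m / real (\<nu> j)))) = 1"
      by (rule norm_exp_i_times)
    then show ?thesis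
      using trace[OF j that]
      by (simp only: norm_mult norm_divide norm_of_real) (simp add: divide_right_mono)
  qed
  then show "cmod (complex_of_real (ln (real (\<nu> j)) / (2 * real (\<nu> j))) *
         (\<Sum>k=1..\<nu> j - 1.
            mat_trace (\<rho> (\<gamma> j) ^\<^sub>m k)
              * exp (\<i> * complex_of_real (pi * real k * m / real (\<nu> j)))
              / complex_of_real ((sin (pi * real k / real (\<nu> j)))\<^sup>2)))
        \<le> \<bar>ln (real (\<nu> j)) / (2 * real (\<nu> j))\<bar> *
            (\<Sum>k=1..\<nu> j - 1. C / (sin (pi * real k / real (\<nu> j)))\<^sup>2)"
    unfolding norm_mult norm_of_real
    by (intro mult_left_mono sum_norm_le) auto
qed

lemma bounded_divide_nat_at_top_tendsto_0:
  fixes f :: "'b \<Rightarrow> 'a :: real_normed_field" and d :: "'b \<Rightarrow> nat"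
  assumes bound: "\<forall>\<^sub>F x in F. norm (f x) \<le> B" and d: "filterlim d at_top F"
  shows "((\<lambda>x. f x / of_nat (d x)) \<longlongrightarrow> 0) F"
proof (rule Lim_null_comparison)
  show "\<forall>\<^sub>F x in F. norm (f x / of_nat (d x)) \<le> B / real (d x)"
    using bound by eventually_elim (simp add: norm_divide divide_right_mono)
  show "((\<lambda>x. B / real (d x)) \<longlongrightarrow> 0) F"
    by (intro real_tendsto_divide_at_top[OF tendsto_const]
          filterlim_compose[OF filterlim_real_sequentially d])
qed

theorem corollary7p2:
  fixes \<Gamma> :: "(real^2^2) set set"
    and g r :: nat
    and z :: "nat \<Rightarrow> complex"
    and \<nu> :: "nat \<Rightarrow> nat"
    and \<gamma> :: "nat \<Rightarrow> (real \<Rightarrow> (real^2^2) set) set"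
    and d :: "nat \<Rightarrow> nat"
    and m :: "nat \<Rightarrow> real"
    and \<rho> :: "nat \<Rightarrow> (real \<Rightarrow> (real^2^2) set) set \<Rightarrow> complex mat"
    and C :: real
  assumes "cocompact_fuchsian \<Gamma>"
    and "has_genus (orbit_space \<Gamma>) g"
    and "\<And>j. j \<in> {1..r} \<Longrightarrow> z j \<in> upper_half_plane"
    and "bij_betw (\<lambda>j. orbit_of \<Gamma> (z j)) {1..r} (elliptic_points \<Gamma>)"
    and "\<And>j. j \<in> {1..r} \<Longrightarrow> \<nu> j = card (stabilizer_of \<Gamma> (z j)) \<and> \<nu> j \<ge> 2"
    and "\<And>j. j \<in> {1..r} \<Longrightarrow> elliptic_generator \<Gamma> (z j) (\<nu> j) (\<gamma> j)"
    and "\<And>N. N \<ge> 1 \<Longrightarrow> \<rho> N \<in> hom (pi1_unit_tangent \<Gamma>) (GL (d N))"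
    and "\<And>N. N \<ge> 1 \<Longrightarrow> m N \<in> {-1<..1}"
    and "\<And>N. N \<ge> 1 \<Longrightarrow>
           \<rho> N central_u = exp (- \<i> * complex_of_real (pi * m N)) \<cdot>\<^sub>m 1\<^sub>m (d N)"
    and "\<And>N j k. N \<ge> 1 \<Longrightarrow> j \<in> {1..r} \<Longrightarrow> k \<in> {1..\<nu> j - 1} \<Longrightarrow>
           cmod (mat_trace (\<rho> N (\<gamma> j) ^\<^sub>m k)) \<le> C"
    and "filterlim d at_top sequentially"
  shows "(\<lambda>N. torsion_factor g r \<nu> \<gamma> (d N) (m N) (\<rho> N) / of_nat (d N))
           \<longlonglongrightarrow> - complex_of_real (orbifold_euler_char g r \<nu>) *
               (2 * deriv riemann_zeta (-1) - complex_of_real (ln (sqrt (2 * pi))))"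
proof -
  let ?E = "\<lambda>N. elliptic_contribution r \<nu> \<gamma> (m N) (\<rho> N)"
  let ?L = "- complex_of_real (orbifold_euler_char g r \<nu>) *
               (2 * deriv riemann_zeta (-1) - complex_of_real (ln (sqrt (2 * pi))))"
  have "\<forall>\<^sub>F N in sequentially. cmod (?E N) \<le>
          (\<Sum>j=1..r. \<bar>ln (real (\<nu> j)) / (2 * real (\<nu> j))\<bar> *
             (\<Sum>k=1..\<nu> j - 1. C / (sin (pi * real k / real (\<nu> j)))\<^sup>2))"
    using eventually_ge_at_top[of 1]
    by eventually_elim (rule norm_elliptic_contribution_le, rule assms(10))
  then have "(\<lambda>N. ?E N / of_nat (d N)) \<longlonglongrightarrow> 0"
    using assms(11) by (rule bounded_divide_nat_at_top_tendsto_0)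
  then have "(\<lambda>N. ?L + ?E N / of_nat (d N)) \<longlonglongrightarrow> ?L"
    by (rule tendsto_add[OF tendsto_const, where b = 0, unfolded add_0_right])
  moreover have "\<forall>\<^sub>F N in sequentially.
      ?L + ?E N / of_nat (d N) = torsion_factor g r \<nu> \<gamma> (d N) (m N) (\<rho> N) / of_nat (d N)"
    using eventually_compose_filterlim[OF eventually_gt_at_top[of 0] assms(11)]
    by eventually_elim (simp only: torsion_factor_div_dim)
  ultimately show ?thesis
    by (rule Lim_transform_eventually)
qed

end
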